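(* For all integers $r,n\ge 1$, $$ r\,n^{1/r} \;\ge\; |P(n,?,1,r)| \;\ge\; r\,n^{1/r}-2r+1 .$$
   Context: Search model $P(n,?,d,r)$: an unknown set $E\subseteq [n]=\{1,\dots,n\}$ (possibly empty) of "excellent" elements is fixed. A Questioner proceeds in $r$ rounds; in round $t$ ($1\le t\le r$) he poses a finite family of queries, i.e. subsets $A\subseteq[n]$, chosen depending only on the answers received in rounds $1,\dots,t-1$ (queries within one round are posed simultaneously). The answer to a query $A$ is "yes" if $A\cap E\neq\emptyset$ and "no" otherwise. After round $r$ the Questioner must either name $d$ distinct elements that are guaranteed to be excellent, or correctly state that there are at most $d-1$ excellent elements; the output must be correct for every set $E$ consistent with all the answers received. $|P(n,?,d,r)|$ denotes the complexity of this problem: the minimum, over all such $r$-round strategies, of the maximum over all $E\subseteq[n]$ of the total number of queries asked. For $d=1$ the goal is to find one excellent element or state that there is none. *)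

theory Defs
  imports Complex_Main
begin

definition answer :: "nat set \<Rightarrow> nat set \<Rightarrow> bool" where
  "answer E A \<longleftrightarrow> A \<inter> E \<noteq> {}"

text \<open>A history lists, round by round, the answers received so far. A questioning strategy maps
  a history to the family of queries posed in the next round, so the queries of one round
  depend only on the answers of the earlier rounds.\<close>

type_synonym history = "bool list list"
type_synonym questioning = "history \<Rightarrow> nat set list"

primrec history_of :: "questioning \<Rightarrow> nat set \<Rightarrow> nat \<Rightarrow> history" where
  "history_of q E 0 = []"
| "history_of q E (Suc t) = history_of q E t @ [map (answer E) (q (history_of q E t))]"

text \<open>The index \<open>t\<close> is the number of rounds already completed, so \<open>t < r\<close> ranges over
  the \<open>r\<close> rounds.\<close>

definition round_queries :: "questioning \<Rightarrow> nat set \<Rightarrow> nat \<Rightarrow> nat set list" where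
  "round_queries q E t = q (history_of q E t)"

definition num_queries :: "questioning \<Rightarrow> nat \<Rightarrow> nat set \<Rightarrow> nat" where
  "num_queries q r E = (\<Sum>t<r. length (round_queries q E t))"

definition consistent :: "questioning \<Rightarrow> nat \<Rightarrow> nat set \<Rightarrow> nat set \<Rightarrow> bool" where
  "consistent q r E E' \<longleftrightarrow>
     (\<forall>t<r. \<forall>A\<in>set (round_queries q E t). answer E' A = answer E A)"

datatype verdict = Excellent "nat set" | Too_Few

fun correct_verdict :: "nat \<Rightarrow> verdict \<Rightarrow> nat set \<Rightarrow> bool" where
  "correct_verdict d (Excellent D) E \<longleftrightarrow> card D = d \<and> D \<subseteq> E"
| "correct_verdict d Too_Few E \<longleftrightarrow> card E < d"

definition solves :: "nat \<Rightarrow> nat \<Rightarrow> nat \<Rightarrow> questioning \<Rightarrow> (history \<Rightarrow> verdict) \<Rightarrow> bool" where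
  "solves n d r q out \<longleftrightarrow>
     (\<forall>E\<subseteq>{1..n}.
        (\<forall>t<r. \<forall>A\<in>set (round_queries q E t). A \<subseteq> {1..n}) \<and>
        (\<forall>E'\<subseteq>{1..n}. consistent q r E E' \<longrightarrow> correct_verdict d (out (history_of q E r)) E'))"

definition worst_case :: "nat \<Rightarrow> nat \<Rightarrow> questioning \<Rightarrow> nat" where
  "worst_case n r q = Max (num_queries q r ` Pow {1..n})"

text \<open>For \<open>r \<ge> 1\<close> the infimum is a minimum over a nonempty set: asking all singletons in the
  first round determines the unknown set.\<close>

definition search_complexity :: "nat \<Rightarrow> nat \<Rightarrow> nat \<Rightarrow> nat" where
  "search_complexity n d r = Inf {worst_case n r q | q. \<exists>out. solves n d r q out}"

end

theory Submission
  imports Defs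
begin

text \<open>Upper bound: split the candidates into \<open>k\<^sub>1\<close> parts, each of these into \<open>k\<^sub>2\<close> parts, and so on,
  where \<open>k\<^sub>1 \<cdots> k\<^sub>r \<ge> n\<close>. Once the candidates are known to contain an excellent element, the last part
  need not be queried, so \<open>\<Sum>(k\<^sub>i - 1)\<close> queries suffice, plus one for the whole set. Factors
  \<open>k\<^sub>i\<close> that are all equal to the floor or ceiling of \<open>n powr (1/r)\<close> give the bound.

  Lower bound: the adversary keeps a set \<open>V\<close> and a number \<open>m\<close> such that every query so far misses
  \<open>V\<close> or meets it in at least \<open>m\<close> elements. Facing \<open>k\<close> new queries it deletes from \<open>V\<close> those
  queries that contain fewer than \<open>m / (k + 1)\<close> surviving elements, which preserves the invariant
  for \<open>m / (k + 1)\<close>. While \<open>m > 1\<close> no element of \<open>V\<close> is certain to be excellent, hence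
  \<open>\<Prod>(k\<^sub>i + 1) \<ge> n\<close> at the end, and the inequality of the means applies.\<close>

section \<open>Histories\<close>

text \<open>\<open>consistent\<close> mentions only the queries posed when the hidden set is
  \<open>E\<close>. By induction on the rounds these are also the queries posed when it is
  \<open>E'\<close>.\<close>

lemma history_of_cong:
  assumes "consistent q r E E'" "t \<le> r"
  shows "history_of q E' t = history_of q E t"
  using assms(2)
proof (induction t)
  case (Suc t)
  then have "history_of q E' t = history_of q E t" "t < r" by auto
  with assms(1) show ?case
    by (auto simp: consistent_def round_queries_def)
qed simp

text \<open>\<open>history_of\<close> grows at its end, while a splitting strategy recurses after
  its first round. Once the first answers are fixed, what remains is again a questioning
  strategy.\<close>

lemma history_of_Suc_shift:
  "history_of q E (Suc t) =
     map (answer E) (q []) # history_of (\<lambda>h. q (map (answer E) (q []) # h)) E t"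
  by (induction t) auto

lemma num_queries_Suc_shift:
  "num_queries q (Suc r) E =
     length (q []) + num_queries (\<lambda>h. q (map (answer E) (q []) # h)) r E"
  unfolding num_queries_def round_queries_def sum.lessThan_Suc_shift history_of_Suc_shift
  by simp

text \<open>Consistent sets produce the same history, so it is enough to check the verdict against
  the hidden set itself.\<close>

lemma solvesI:
  assumes "\<And>h A. A \<in> set (q h) \<Longrightarrow> A \<subseteq> {1..n}"
    and "\<And>E. E \<subseteq> {1..n} \<Longrightarrow> correct_verdict d (out (history_of q E r)) E"
  shows "solves n d r q out"
  unfolding solves_def
proof (intro allI impI conjI ballI)
  fix E t A assume "A \<in> set (round_queries q E t)"
  then show "A \<subseteq> {1..n}" using assms(1) by (auto simp: round_queries_def)
next
  fix E E' assume "E' \<subseteq> {1..n}" "consistent q r E E'"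
  then show "correct_verdict d (out (history_of q E r)) E'"
    using assms(2)[of E'] history_of_cong[of q r E E' r] by simp
qed

section \<open>The splitting strategy\<close>

lemma partition_card_le:
  fixes V :: "'a set"
  assumes "finite V" "card V \<le> k * p"
  shows "\<exists>P. V = (\<Union>i<k. P i) \<and> (\<forall>i. card (P i) \<le> p)"
  using assms
proof (induction k arbitrary: V)
  case 0
  then show ?case by (intro exI[of _ "\<lambda>_. {}"]) auto
next
  case (Suc k)
  obtain S where S: "S \<subseteq> V" "card S = min p (card V)"
    by (meson obtain_subset_with_card_n min.cobounded2)
  have fS: "finite S" using S Suc.prems finite_subset by blast
  have "card (V - S) = card V - card S" using S fS by (simp add: card_Diff_subset)
  also have "\<dots> \<le> k * p" using S Suc.prems by auto
  finally obtain P where P: "V - S = (\<Union>i<k. P i)" "\<forall>i. card (P i) \<le> p"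
    using Suc.IH[of "V - S"] Suc.prems by auto
  have "V = (\<Union>i<Suc k. (P(k := S)) i)"
  proof -
    have "(\<Union>i<Suc k. (P(k := S)) i) = S \<union> (\<Union>i<k. P i)"
      by (auto simp: lessThan_Suc)
    then show ?thesis using P S by auto
  qed
  then show ?case using P S by (intro exI[of _ "P(k := S)"]) auto
qed

text \<open>The set \<open>E\<close> is not confined to \<open>V\<close>, so the induction
  hypothesis for a part applies to \<open>E\<close> unchanged. Nothing is promised about the output
  when \<open>E\<close> misses \<open>V\<close>.\<close>

lemma search_nonempty:
  fixes V :: "nat set"
  assumes "finite V" "card V \<le> prod_list ks" "0 \<notin> set ks"
  shows "\<exists>q out. (\<forall>h. \<forall>A\<in>set (q h). A \<subseteq> V) \<and>
           (\<forall>E. num_queries q (length ks) E + length ks \<le> sum_list ks) \<and>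
           (\<forall>E. E \<inter> V \<noteq> {} \<longrightarrow> out (history_of q E (length ks)) \<in> E)"
  using assms
proof (induction ks arbitrary: V)
  case Nil
  \<comment> \<open>The empty product is 1, so a set \<open>V\<close> that meets \<open>E\<close> is
    a singleton and needs no query.\<close>
  have "the_elem V \<in> E" if "E \<inter> V \<noteq> {}" for E
  proof -
    have "card V = 1" using that Nil.prems by (auto simp: le_Suc_eq)
    then obtain x where "V = {x}" by (auto simp: card_1_singleton_iff)
    then show ?thesis using that by auto
  qed
  then show ?case
    by (intro exI[of _ "\<lambda>_. []"] exI[of _ "\<lambda>_. the_elem V"]) (auto simp: num_queries_def)
next
  case (Cons k ks)
  then have k: "k \<ge> 1" by (cases k) auto
  obtain P where P: "V = (\<Union>i<k. P i)" "\<And>i. card (P i) \<le> prod_list ks"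
    using partition_card_le[of V k "prod_list ks"] Cons.prems by auto
  \<comment> \<open>With \<open>i < k\<close> inside the existential, strategies can be chosen
    simultaneously as total functions of \<open>i\<close>.\<close>
  have "\<exists>q out. i < k \<longrightarrow> (\<forall>h. \<forall>A\<in>set (q h). A \<subseteq> P i) \<and>
           (\<forall>E. num_queries q (length ks) E + length ks \<le> sum_list ks) \<and>
           (\<forall>E. E \<inter> P i \<noteq> {} \<longrightarrow> out (history_of q E (length ks)) \<in> E)" for i
  proof (cases "i < k")
    case True
    then have "finite (P i)" using P Cons.prems by (metis finite_UN finite_lessThan lessThan_iff)
    then show ?thesis using Cons.IH[of "P i"] P Cons.prems by auto
  qed auto
  then obtain Q Out where Q: "\<And>i. i < k \<Longrightarrow> (\<forall>h. \<forall>A\<in>set (Q i h). A \<subseteq> P i) \<and>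
           (\<forall>E. num_queries (Q i) (length ks) E + length ks \<le> sum_list ks) \<and>
           (\<forall>E. E \<inter> P i \<noteq> {} \<longrightarrow> Out i (history_of (Q i) E (length ks)) \<in> E)"
    by metis
  \<comment> \<open>The default \<open>k - 1\<close> is the part that was not queried: it must meet
    \<open>E\<close> if no other part does.\<close>
  define sel where "sel a = (if \<exists>j<k - 1. a ! j then SOME j. j < k - 1 \<and> a ! j else k - 1)"
    for a :: "bool list"
  define q where
    "q h = (case h of [] \<Rightarrow> map P [0..<k - 1] | a # h' \<Rightarrow> Q (sel a) h')" for h
  define out where "out h = Out (sel (hd h)) (tl h)" for h :: history
  have sel: "sel a < k" for a
  proof (cases "\<exists>j<k - 1. a ! j")
    case True
    then have "sel a < k - 1" using someI_ex[OF True] by (simp add: sel_def)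
    then show ?thesis by simp
  next
    case False
    then have "sel a = k - 1" unfolding sel_def by (rule if_not_P)
    then show ?thesis using k by simp
  qed
  define a where "a E = map (answer E) (q [])" for E
  have shift: "(\<lambda>h. q (a E # h)) = Q (sel (a E))" for E
    by (auto simp: q_def)
  have "A \<subseteq> V" if "A \<in> set (q h)" for h A
  proof (cases h)
    case Nil
    then show ?thesis using that P(1) by (auto simp: q_def)
  next
    case (Cons b h')
    then have "A \<subseteq> P (sel b)" using that Q[OF sel[of b]] by (auto simp: q_def)
    then show ?thesis using P(1) sel[of b] by auto
  qed
  moreover have "num_queries q (length (k # ks)) E + length (k # ks) \<le> sum_list (k # ks)" for E
  proof -
    have "num_queries q (length (k # ks)) E =
        k - 1 + num_queries (Q (sel (a E))) (length ks) E"
      using num_queries_Suc_shift[of q "length ks" E] shift[of E] by (simp add: a_def q_def)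
    then show ?thesis using Q[OF sel[of "a E"]] k
      by (auto dest: spec[of _ E])
  qed
  moreover have "out (history_of q E (length (k # ks))) \<in> E" if E: "E \<inter> V \<noteq> {}" for E
  proof -
    have nth: "a E ! j = answer E (P j)" if "j < k - 1" for j
      using that by (simp add: a_def q_def)
    have "E \<inter> P (sel (a E)) \<noteq> {}"
    proof (cases "\<exists>j<k - 1. a E ! j")
      case True
      then have "sel (a E) < k - 1" "a E ! sel (a E)"
        using someI_ex[of "\<lambda>j. j < k - 1 \<and> a E ! j"] by (auto simp: sel_def)
      then show ?thesis using nth by (auto simp: answer_def)
    next
      case False
      then have "E \<inter> P j = {}" if "j < k - 1" for j
        using that nth[of j] by (auto simp: answer_def)
      moreover obtain j where "j < k" "E \<inter> P j \<noteq> {}" using E P(1) by auto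
      moreover have "j < k - 1 \<or> j = k - 1" using \<open>j < k\<close> by linarith
      ultimately have "E \<inter> P (k - 1) \<noteq> {}" by blast
      moreover have "sel (a E) = k - 1" unfolding sel_def using False by (rule if_not_P)
      ultimately show ?thesis by simp
    qed
    moreover have "history_of q E (length (k # ks)) =
        a E # history_of (Q (sel (a E))) E (length ks)"
      using history_of_Suc_shift[of q E "length ks"] shift[of E] by (simp add: a_def)
    ultimately show ?thesis using Q[OF sel[of "a E"]] by (simp add: out_def)
  qed
  ultimately show ?case by blast
qed

lemma solves_splitting:
  assumes "n \<le> prod_list ks" "0 \<notin> set ks" "ks \<noteq> []"
  shows "\<exists>q out. solves n 1 (length ks) q out \<and>
           (\<forall>E. num_queries q (length ks) E + length ks \<le> sum_list ks + 1)"
proof -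
  let ?V = "{1..n}"
  obtain q out where q: "\<forall>h. \<forall>A\<in>set (q h). A \<subseteq> ?V"
      "\<forall>E. num_queries q (length ks) E + length ks \<le> sum_list ks"
      "\<forall>E. E \<inter> ?V \<noteq> {} \<longrightarrow> out (history_of q E (length ks)) \<in> E"
    using search_nonempty[of ?V ks, OF _ _ assms(2)] assms(1) by auto
  obtain r where r: "length ks = Suc r" using assms(3) by (cases ks) auto
  \<comment> \<open>The query for the whole set joins the first round, so it costs no extra round.
    Its answer is removed by \<open>tl\<close> before the history is passed to
    \<open>q\<close>.\<close>
  define q' where "q' h = (case h of [] \<Rightarrow> ?V # q [] | a # h' \<Rightarrow> q (tl a # h'))" for h
  define out' where "out' h =
      (if hd (hd h) then Excellent {out (tl (hd h) # tl h)} else Too_Few)" for h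
  have shift: "(\<lambda>h. q' (map (answer E) (q' []) # h)) = (\<lambda>h. q (map (answer E) (q []) # h))" for E
    by (auto simp: q'_def)
  have q'Nil: "q' [] = ?V # q []" by (simp add: q'_def)
  have hist: "history_of q' E (Suc r) = map (answer E) (?V # q []) #
      history_of (\<lambda>h. q (map (answer E) (q []) # h)) E r" for E
    unfolding history_of_Suc_shift[of q'] shift by (simp only: q'Nil)
  have "correct_verdict 1 (out' (history_of q' E (length ks))) E" if "E \<subseteq> ?V" for E
  proof (cases "E = {}")
    case True
    then show ?thesis unfolding r hist by (simp add: out'_def answer_def)
  next
    case False
    then have "E \<inter> ?V \<noteq> {}" using that by auto
    then show ?thesis
      using q(3)[rule_format, of E] unfolding r hist history_of_Suc_shift[of q]
      by (auto simp: out'_def answer_def)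
  qed
  moreover have "A \<subseteq> ?V" if "A \<in> set (q' h)" for h A
    using that q(1) by (cases h) (fastforce simp: q'_def)+
  ultimately have "solves n 1 (length ks) q' out'" by (intro solvesI)
  moreover have "num_queries q' (length ks) E + length ks \<le> sum_list ks + 1" for E
    using q(2)[rule_format, of E] unfolding r num_queries_Suc_shift[of q']
      num_queries_Suc_shift[of q] shift
    by (simp add: q'Nil)
  ultimately show ?thesis by blast
qed

lemma search_complexity_le:
  assumes "n \<le> prod_list ks" "0 \<notin> set ks" "ks \<noteq> []"
  shows "search_complexity n 1 (length ks) + length ks \<le> sum_list ks + 1"
proof -
  obtain q out where q: "solves n 1 (length ks) q out"
      "\<And>E. num_queries q (length ks) E + length ks \<le> sum_list ks + 1"
    using solves_splitting[OF assms] by blast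
  have "search_complexity n 1 (length ks) \<le> worst_case n (length ks) q"
    unfolding search_complexity_def using q(1) by (intro cInf_lower) auto
  moreover have "worst_case n (length ks) q \<in> num_queries q (length ks) ` Pow {1..n}"
    unfolding worst_case_def by (intro Max_in) auto
  then have "worst_case n (length ks) q + length ks \<le> sum_list ks + 1" using q(2) by auto
  ultimately show ?thesis by linarith
qed

section \<open>Integer factors close to the r-th root\<close>

text \<open>With \<open>y = 1 / m\<close>, divide by \<open>m ^ r\<close> and compare both sides
  with exp(y), which is at most 1 + y + y^2 since y \<le> 1. The hypothesis r \<ge> 3 gives (1 +
  y)^2 \<le> (1 + y)^(r - 1).\<close>

lemma one_plus_inverse_power_le:
  fixes m r :: nat
  assumes "m \<ge> 1" "r \<ge> 3"
  shows "(real m + 1 / real r) ^ r \<le> real m * (real m + 1) ^ (r - 1)"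
proof -
  define y where "y = 1 / real m"
  have y: "0 < y" "y \<le> 1" using assms by (auto simp: y_def)
  have my: "real m * y = 1" using assms by (simp add: y_def)
  have "(1 + y / real r) ^ r \<le> exp (y / real r) ^ r"
    using y by (intro power_mono) auto
  also have "\<dots> = exp y" using assms by (simp flip: exp_of_nat_mult)
  also have "\<dots> \<le> 1 + y + y\<^sup>2" using y by (intro exp_bound) auto
  also have "\<dots> \<le> (1 + y) ^ 2" using y by (simp add: power2_eq_square algebra_simps)
  also have "\<dots> \<le> (1 + y) ^ (r - 1)" using y assms by (intro power_increasing) auto
  finally have "real m ^ r * (1 + y / real r) ^ r \<le> real m ^ r * (1 + y) ^ (r - 1)"
    by (intro mult_left_mono) auto
  moreover have "real m ^ r * (1 + y / real r) ^ r = (real m + 1 / real r) ^ r"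
    using my by (simp add: distrib_left flip: power_mult_distrib)
  moreover have "real m ^ r * (1 + y) ^ (r - 1) = real m * (real m + 1) ^ (r - 1)"
  proof -
    have "real m ^ r = real m * real m ^ (r - 1)" using assms by (simp flip: power_Suc)
    then show ?thesis using my by (simp add: distrib_left flip: power_mult_distrib)
  qed
  ultimately show ?thesis by simp
qed

lemma balanced_factors:
  fixes n r :: nat
  assumes "r \<ge> 1" "n \<ge> 1"
  defines "x \<equiv> real n powr (1 / real r)"
  shows "\<exists>ks. length ks = r \<and> 0 \<notin> set ks \<and> n \<le> prod_list ks \<and>
           real (sum_list ks) + 1 \<le> real r * x + real r"
proof -
  define m where "m = nat \<lfloor>x\<rfloor>"
  have x1: "x \<ge> 1" using assms by (auto simp: x_def ge_one_powr_ge_zero)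
  have m: "m \<ge> 1" "real m \<le> x" "x < real m + 1"
    using x1 by (auto simp: m_def le_nat_floor)
  have xr: "x ^ r = real n"
    using assms by (simp add: x_def powr_powr flip: powr_realpow)
  \<comment> \<open>With \<open>a\<close> factors \<open>m + 1\<close> and the others
    \<open>m\<close>, the sum is r m + a. The budget thus allows a \<le> r (x - m) + r - 1: always
    \<open>r - 1\<close> large factors, and all \<open>r\<close> once x \<ge> m + 1/r.\<close>
  have *: ?thesis if "a \<le> r" "n \<le> (m + 1) ^ a * m ^ (r - a)"
    "real r * real m + real a + 1 \<le> real r * x + real r" for a
  proof -
    have "a * (m + 1) + (r - a) * m = r * m + a"
      using that(1) by (metis add.assoc add.commute add_mult_distrib le_add_diff_inverse2
          mult.right_neutral distrib_left)
    then show ?thesis using that m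
      by (intro exI[of _ "replicate a (m + 1) @ replicate (r - a) m"])
         (auto simp: sum_list_replicate simp flip: of_nat_mult of_nat_add)
  qed
  consider "x = real m" | "x \<ge> real m + 1 / real r"
    | "x \<noteq> real m" "x < real m + 1 / real r" by linarith
  then show ?thesis
  proof cases
    case 1
    then have "n = m ^ r" using xr by (metis of_nat_eq_iff of_nat_power)
    then show ?thesis using 1 assms by (intro *[of 0]) auto
  next
    case 2
    have "real n \<le> (real m + 1) ^ r" unfolding xr[symmetric] using m x1 by (intro power_mono) auto
    then have "n \<le> (m + 1) ^ r"
      by (metis of_nat_1 of_nat_add of_nat_le_iff of_nat_power)
    moreover have "real r * real m + 1 \<le> real r * x"
      using mult_left_mono[OF 2, of "real r"] assms by (simp add: distrib_left)
    ultimately show ?thesis by (intro *[of r]) auto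
  next
    case 3
    have "r \<noteq> 1"
    proof
      assume "r = 1"
      then have "x = real n" using assms by simp
      then show False using 3 by (simp add: m_def)
    qed
    then have r2: "r \<ge> 2" using assms by simp
    have lt: "real n < (real m + 1 / real r) ^ r"
      unfolding xr[symmetric] using 3 x1 r2 by (intro power_strict_mono) auto
    have "n \<le> (m + 1) ^ (r - 1) * m"
    proof (cases "r = 2")
      case True
      \<comment> \<open>Here the real bound exceeds \<open>m (m + 1)\<close> by \<open>1/4\<close>, so integrality of \<open>n\<close> is needed.\<close>
      then have "real n < real ((m + 1) * m) + 1"
        using lt by (simp add: power2_eq_square algebra_simps)
      then have "n < (m + 1) * m + 1" by linarith
      then show ?thesis using True by simp
    next
      case False
      then have "real n < real ((m + 1) ^ (r - 1) * m)"
        using lt one_plus_inverse_power_le[of m r] m r2 by (simp add: mult.commute add.commute)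
      then show ?thesis by linarith
    qed
    moreover have "real r * real m \<le> real r * x" using m by (intro mult_left_mono) auto
    ultimately show ?thesis using r2 by (intro *[of "r - 1"]) auto
  qed
qed

section \<open>The adversary\<close>

text \<open>Among the subfamilies \<open>S\<close> whose union covers at most
  \<open>s * card S\<close> elements of \<open>V\<close>, take a largest one and delete its union. A
  query left with some, but fewer than \<open>s\<close>, elements could be added to
  \<open>S\<close>.\<close>

lemma delete_small_queries:
  fixes V :: "'a set" and s :: real
  assumes "finite V" "finite Q" "s \<ge> 0"
  shows "\<exists>W\<subseteq>V. real (card (V - W)) \<le> s * real (card Q) \<and>
           (\<forall>A\<in>Q. A \<inter> W = {} \<or> s \<le> real (card (A \<inter> W)))"
proof -
  define good where "good S \<longleftrightarrow> S \<subseteq> Q \<and> real (card (V \<inter> \<Union>S)) \<le> s * real (card S)" for S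
  have "good {}" by (simp add: good_def)
  moreover have "\<forall>S. good S \<longrightarrow> card S < Suc (card Q)"
    using assms(2) by (auto simp: good_def less_Suc_eq_le intro: card_mono)
  ultimately obtain S where S: "good S" "\<forall>T. good T \<longrightarrow> card T \<le> card S"
    using ex_has_greatest_nat[of good "{}" card "Suc (card Q)"] by auto
  have fS: "finite S" using S(1) assms by (auto simp: good_def intro: finite_subset)
  let ?W = "V - \<Union>S"
  have "s \<le> real (card (A \<inter> ?W))" if A: "A \<in> Q" "A \<inter> ?W \<noteq> {}" for A
  proof (rule ccontr)
    assume "\<not> ?thesis"
    then have lt: "real (card (A \<inter> ?W)) < s" by simp
    have nin: "A \<notin> S" using A by auto
    have "V \<inter> \<Union>(insert A S) = (A \<inter> ?W) \<union> (V \<inter> \<Union>S)" by auto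
    then have "card (V \<inter> \<Union>(insert A S)) \<le> card (A \<inter> ?W) + card (V \<inter> \<Union>S)"
      using card_Un_le by metis
    then have "real (card (V \<inter> \<Union>(insert A S))) \<le> s + s * real (card S)"
      using lt S(1) by (simp add: good_def)
    then have "good (insert A S)"
      using S(1) A nin fS by (simp add: good_def algebra_simps)
    then show False using S(2) nin fS by fastforce
  qed
  moreover have "real (card (V - ?W)) \<le> s * real (card Q)"
  proof -
    have "V - ?W = V \<inter> \<Union>S" by auto
    then have "real (card (V - ?W)) \<le> s * real (card S)" using S(1) by (simp add: good_def)
    also have "\<dots> \<le> s * real (card Q)"
      using S(1) assms by (intro mult_left_mono) (auto simp: good_def card_mono)
    finally show ?thesis .
  qed
  ultimately show ?thesis by (intro exI[of _ ?W]) auto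
qed

text \<open>The set \<open>V\<close> is both the surviving set and the hidden set that determines
  the answers. Shrinking it keeps the earlier answers, because every query that met it still
  does.\<close>

lemma adversary:
  fixes n t :: nat
  assumes "n \<ge> 1"
  shows "\<exists>V\<subseteq>{1..n}. \<exists>m>0.
           m * (\<Prod>i<t. real (length (round_queries q V i)) + 1) = real n \<and> m \<le> real (card V) \<and>
           (\<forall>i<t. \<forall>A\<in>set (round_queries q V i). A \<inter> V = {} \<or> m \<le> real (card (A \<inter> V)))"
proof (induction t)
  case 0
  show ?case
    by (rule exI[of _ "{1..n}"], intro conjI, simp, rule exI[of _ "real n"]) (use assms in auto)
next
  case (Suc t)
  then obtain V m where V: "V \<subseteq> {1..n}" "m > 0"
      "m * (\<Prod>i<t. real (length (round_queries q V i)) + 1) = real n" "m \<le> real (card V)"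
      "\<forall>i<t. \<forall>A\<in>set (round_queries q V i). A \<inter> V = {} \<or> m \<le> real (card (A \<inter> V))"
    by blast
  have fV: "finite V" using V(1) finite_subset by blast
  define k where "k = real (length (round_queries q V t))"
  \<comment> \<open>This value solves m - s k = s: a query with \<open>m\<close> elements keeps at
    least \<open>s\<close> after \<open>s * k\<close> deletions.\<close>
  define s where "s = m / (k + 1)"
  have k0: "k \<ge> 0" by (simp add: k_def)
  have s: "s > 0" "m - s * k = s" using V(2) k0 by (auto simp: s_def field_simps)
  obtain W where W: "W \<subseteq> V" "real (card (V - W)) \<le> s * real (card (set (round_queries q V t)))"
      "\<forall>A\<in>set (round_queries q V t). A \<inter> W = {} \<or> s \<le> real (card (A \<inter> W))"
    using delete_small_queries[OF fV, of "set (round_queries q V t)" s] s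
    by (meson finite_set less_imp_le)
  have "s * real (card (set (round_queries q V t))) \<le> s * k"
    using s by (intro mult_left_mono) (auto simp: k_def card_length)
  then have del: "real (card (V - W)) \<le> s * k" using W(2) by linarith
  have shrink: "s \<le> real (card (A \<inter> W))" if "m \<le> real (card (A \<inter> V))" for A
  proof -
    have "A \<inter> V \<subseteq> (A \<inter> W) \<union> (V - W)" by auto
    then have "card (A \<inter> V) \<le> card ((A \<inter> W) \<union> (V - W))"
      using fV W(1) by (intro card_mono) (auto intro: finite_subset)
    also have "\<dots> \<le> card (A \<inter> W) + card (V - W)" by (rule card_Un_le)
    finally show ?thesis using that del s by linarith
  qed
  have old: "A \<inter> W = {} \<and> A \<inter> V = {} \<or> A \<inter> V \<noteq> {} \<and> A \<inter> W \<noteq> {} \<and> s \<le> real (card (A \<inter> W))"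
    if "i < t" "A \<in> set (round_queries q V i)" for i A
    using V(5)[rule_format, OF that] shrink[of A] W(1) s(1) V(2)
    by (cases "A \<inter> V = {}") auto
  \<comment> \<open>Agreement on the rounds before \<open>t\<close> also fixes the queries of round
    \<open>t\<close>, hence i \<le> t below.\<close>
  have "consistent q t V W"
    using old by (auto simp: consistent_def answer_def)
  then have rq: "round_queries q W i = round_queries q V i" if "i \<le> t" for i
    using history_of_cong[of q t V W i] that by (simp add: round_queries_def)
  have "s * (\<Prod>i<Suc t. real (length (round_queries q W i)) + 1) =
      s * (k + 1) * (\<Prod>i<t. real (length (round_queries q V i)) + 1)"
    using rq by (simp add: k_def)
  also have "s * (k + 1) = m" using k0 by (simp add: s_def)
  finally have "s * (\<Prod>i<Suc t. real (length (round_queries q W i)) + 1) = real n"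
    using V(3) by simp
  moreover have "s \<le> real (card W)" using shrink[of V] V(4) W(1) by (simp add: inf.absorb2)
  moreover have "A \<inter> W = {} \<or> s \<le> real (card (A \<inter> W))"
    if "i < Suc t" "A \<in> set (round_queries q W i)" for i A
    using that rq[of i] old[of i A] W(3) by (cases "i = t") auto
  ultimately show ?case using s(1) W(1) V(1) by blast
qed

text \<open>If m > 1, every query meeting \<open>V\<close> meets it at least twice, so
  \<open>V\<close> and \<open>V - {x}\<close> get equal answers. Then no \<open>x\<close> can be
  named, and \<open>Too_Few\<close> is wrong because \<open>V\<close> is nonempty.\<close>

lemma solves_prod_ge:
  assumes "solves n 1 r q out" "n \<ge> 1"
  shows "\<exists>V\<subseteq>{1..n}. real n \<le> (\<Prod>i<r. real (length (round_queries q V i)) + 1)"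
proof -
  obtain V m where V: "V \<subseteq> {1..n}" "m > 0"
      "m * (\<Prod>i<r. real (length (round_queries q V i)) + 1) = real n" "m \<le> real (card V)"
      "\<forall>i<r. \<forall>A\<in>set (round_queries q V i). A \<inter> V = {} \<or> m \<le> real (card (A \<inter> V))"
    using adversary[OF assms(2), of q r] by blast
  have verdict: "correct_verdict 1 (out (history_of q V r)) E'"
    if "E' \<subseteq> V" "consistent q r V E'" for E'
  proof -
    have "E' \<subseteq> {1..n}" using that(1) V(1) by (rule subset_trans)
    then show ?thesis using assms(1) V(1) that(2) unfolding solves_def by simp
  qed
  have "m \<le> 1"
  proof (rule ccontr)
    assume "\<not> m \<le> 1"
    have "correct_verdict 1 (out (history_of q V r)) V"
      by (rule verdict) (auto simp: consistent_def)
    moreover have "\<not> card V < 1" using V(4) \<open>\<not> m \<le> 1\<close> by linarith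
    ultimately obtain D where D: "out (history_of q V r) = Excellent D" "card D = 1"
      by (cases "out (history_of q V r)") auto
    then obtain x where x: "D = {x}" by (auto simp: card_1_singleton_iff)
    have "A \<inter> (V - {x}) \<noteq> {}"
      if "i < r" "A \<in> set (round_queries q V i)" "A \<inter> V \<noteq> {}" for i A
    proof
      assume "A \<inter> (V - {x}) = {}"
      then have "A \<inter> V \<subseteq> {x}" by auto
      then have "card (A \<inter> V) \<le> card {x}" by (intro card_mono) auto
      moreover have "m \<le> real (card (A \<inter> V))" using V(5) that by blast
      ultimately show False using \<open>\<not> m \<le> 1\<close> by simp
    qed
    then have "(A \<inter> (V - {x}) \<noteq> {}) = (A \<inter> V \<noteq> {})"
      if "i < r" "A \<in> set (round_queries q V i)" for i A
      using that by blast
    then have "consistent q r V (V - {x})"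
      by (simp add: consistent_def answer_def)
    then have "correct_verdict 1 (out (history_of q V r)) (V - {x})" by (intro verdict) auto
    then show False using D x by auto
  qed
  then have "real n \<le> 1 * (\<Prod>i<r. real (length (round_queries q V i)) + 1)"
    unfolding V(3)[symmetric] by (intro mult_right_mono prod_nonneg) auto
  then show ?thesis using V(1) by auto
qed

section \<open>The inequality of the means and the final bounds\<close>

text \<open>Sum ln t \<le> t - 1 over the ratios \<open>f i / g\<close>, where \<open>g\<close> is
  the r-th root of \<open>p\<close>; the terms \<open>r * ln g\<close> cancel.\<close>

lemma arith_geo_mean_powr:
  fixes f :: "nat \<Rightarrow> real"
  assumes "r \<ge> 1" "p > 0" "p \<le> (\<Prod>i<r. f i)" "\<And>i. f i > 0"
  shows "real r * p powr (1 / real r) \<le> (\<Sum>i<r. f i)"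
proof -
  define g where "g = p powr (1 / real r)"
  have g: "g > 0" using assms by (simp add: g_def)
  have "real r * ln g = ln p" using assms by (simp add: g_def)
  also have "\<dots> \<le> ln (\<Prod>i<r. f i)" using assms by (simp add: prod_pos)
  also have "\<dots> = (\<Sum>i<r. ln (f i))"
    by (rule ln_prod) (use assms(4) less_imp_neq in \<open>fastforce+\<close>)
  also have "\<dots> \<le> (\<Sum>i<r. f i / g - 1 + ln g)"
  proof (rule sum_mono)
    fix i
    show "ln (f i) \<le> f i / g - 1 + ln g"
      using ln_le_minus_one[of "f i / g"] g assms(4)[of i] by (simp add: ln_div)
  qed
  also have "\<dots> = (\<Sum>i<r. f i) / g - real r + real r * ln g"
    by (simp add: sum.distrib sum_subtractf sum_divide_distrib)
  finally show ?thesis using g by (simp add: g_def field_simps)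
qed

lemma worst_case_ge:
  assumes "solves n 1 r q out" "n \<ge> 1" "r \<ge> 1"
  shows "real r * real n powr (1 / real r) - real r \<le> real (worst_case n r q)"
proof -
  obtain V where V: "V \<subseteq> {1..n}" "real n \<le> (\<Prod>i<r. real (length (round_queries q V i)) + 1)"
    using solves_prod_ge[OF assms(1,2)] by blast
  have "real r * real n powr (1 / real r) \<le> (\<Sum>i<r. real (length (round_queries q V i)) + 1)"
    using V(2) assms by (intro arith_geo_mean_powr) auto
  also have "\<dots> = real (num_queries q r V) + real r"
    by (simp add: num_queries_def sum.distrib)
  also have "num_queries q r V \<le> worst_case n r q"
    unfolding worst_case_def using V(1) by (intro Max_ge) auto
  finally show ?thesis by simp
qed

theorem theorem1p1:
  fixes n r :: nat
  assumes "r \<ge> 1" and "n \<ge> 1"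
  shows "real r * real n powr (1 / real r) \<ge> real (search_complexity n 1 r) \<and>
         real (search_complexity n 1 r) \<ge> real r * real n powr (1 / real r) - 2 * real r + 1"
proof
  obtain ks where ks: "length ks = r" "0 \<notin> set ks" "n \<le> prod_list ks"
      "real (sum_list ks) + 1 \<le> real r * real n powr (1 / real r) + real r"
    using balanced_factors[OF assms] by blast
  then have "ks \<noteq> []" using assms by auto
  have "search_complexity n 1 r + r \<le> sum_list ks + 1"
    using search_complexity_le[OF ks(3,2) \<open>ks \<noteq> []\<close>] ks(1) by simp
  then show "real (search_complexity n 1 r) \<le> real r * real n powr (1 / real r)"
    using ks(4) by linarith
  \<comment> \<open>The splitting strategy shows that the set is nonempty, so its infimum is
    attained by an actual strategy.\<close>
  have "{worst_case n r q |q. \<exists>out. solves n 1 r q out} \<noteq> {}"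
    using solves_splitting[OF ks(3,2) \<open>ks \<noteq> []\<close>] ks(1) by auto
  from Inf_nat_def1[OF this] obtain q out
    where "search_complexity n 1 r = worst_case n r q" "solves n 1 r q out"
    unfolding search_complexity_def by auto
  \<comment> \<open>The bound obtained subtracts only \<open>r\<close>, and r \<le> 2 r - 1 as r
    \<ge> 1.\<close>
  then show "real r * real n powr (1 / real r) - 2 * real r + 1 \<le> real (search_complexity n 1 r)"
    using worst_case_ge[of n r q out] assms by auto
qed

end
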